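(* Let $m,r\ge0$ be integers, let $a,b,c\in\mathbb{C}$ with $c\notin\{0,-1,-2,\ldots\}$ and $a,b\notin\{-1,-2,\ldots,-m\}$, and put $\delta=1+a+b-c$; if $r\ge1$, assume also that $\delta+k\neq0$ for all integers $0\le k\le m-1$. Then $$\sum_{n=0}^{m}\frac{(a)_n(b)_n}{(c)_n n!}\,\mathcal H_r(n;c)=\frac{(a+1)_m(b+1)_m}{(c)_m\,m!}\sum_{j=0}^{m}(-1)^j\binom{m}{j}\frac{(\delta)_j\,j!}{(a+1)_j(b+1)_j}\,\mathcal B_r\bigl(x_1,\ldots,x_r\bigr),$$ where, for $1\le s\le r$, the $s$-th argument (depending on $m$ and $j$) is $$x_s=(s-1)!\left(H_m^{(s)}(c)+(-1)^{s-1}H_j^{(s)}(\delta)\right).$$ For $r=0$ the Bell polynomial is understood to be $\mathcal B_0=1$.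
   Context: Notation: $(u)_0=1$, $(u)_n=u(u+1)\cdots(u+n-1)$. The complete exponential Bell polynomials $\mathcal B_r$ are defined by $\exp\bigl(\sum_{j\ge1}x_j\frac{t^j}{j!}\bigr)=\sum_{r\ge0}\mathcal B_r(x_1,\ldots,x_r)\frac{t^r}{r!}$, $\mathcal B_0=1$. The shifted harmonic numbers are $H_n^{(s)}(z)=\sum_{k=0}^{n-1}\frac{1}{(z+k)^s}$, $H_0^{(s)}(z)=0$, and $$\mathcal H_r(n;c)=\mathcal B_r\bigl(H_n^{(1)}(c),1!\,H_n^{(2)}(c),\ldots,(r-1)!\,H_n^{(r)}(c)\bigr).$$ *)

theory Defs
  imports "HOL-Analysis.Analysis" "HOL-Computational_Algebra.Formal_Power_Series"
begin

text \<open>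
  The complete exponential Bell polynomial \<open>B\<^sub>r(x\<^sub>1, \<dots>, x\<^sub>r)\<close>, read off from
  \<open>exp (\<Sum>j\<ge>1. x\<^sub>j t^j / j!) = (\<Sum>r. B\<^sub>r(x\<^sub>1, \<dots>, x\<^sub>r) t^r / r!)\<close> as formal power series.
  The arguments are passed as a sequence, of which only the entries \<open>1, \<dots>, r\<close> matter
  (see \<open>complete_bell_cong\<close>); in particular \<open>x 0\<close> is never used.
\<close>

definition bell_exponent :: "(nat \<Rightarrow> 'a :: field_char_0) \<Rightarrow> 'a fps" where
  "bell_exponent x = Abs_fps (\<lambda>j. if j = 0 then 0 else x j / fact j)"

definition complete_bell :: "nat \<Rightarrow> (nat \<Rightarrow> 'a :: field_char_0) \<Rightarrow> 'a" where
  "complete_bell r x = fact r * fps_nth (fps_exp 1 oo bell_exponent x) r"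

lemma complete_bell_gf:
  "fps_exp 1 oo bell_exponent x = Abs_fps (\<lambda>r. complete_bell r x / fact r)"
  by (simp add: fps_eq_iff complete_bell_def)

lemma complete_bell_0 [simp]: "complete_bell 0 x = 1"
  by (simp add: complete_bell_def)

lemma fps_power_nth_cong:
  fixes f g :: "'a :: comm_ring_1 fps"
  assumes "\<And>j. j \<le> n \<Longrightarrow> fps_nth f j = fps_nth g j" "k \<le> n"
  shows "fps_nth (f ^ i) k = fps_nth (g ^ i) k"
  using assms(2)
proof (induction i arbitrary: k)
  case (Suc i)
  then show ?case
    using assms(1) by (auto simp: fps_mult_nth intro!: sum.cong)
qed simp

lemma complete_bell_cong:
  assumes "\<And>j. 1 \<le> j \<Longrightarrow> j \<le> r \<Longrightarrow> x j = y j"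
  shows "complete_bell r x = complete_bell r y"
proof -
  have "fps_nth (bell_exponent x ^ i) r = fps_nth (bell_exponent y ^ i) r" for i
    by (rule fps_power_nth_cong[of r]) (auto simp: bell_exponent_def assms)
  then show ?thesis
    by (simp add: complete_bell_def fps_compose_nth)
qed

definition shifted_harm :: "nat \<Rightarrow> nat \<Rightarrow> 'a :: field_char_0 \<Rightarrow> 'a" where
  "shifted_harm s n z = (\<Sum>k<n. 1 / (z + of_nat k) ^ s)"

definition bell_harm :: "nat \<Rightarrow> nat \<Rightarrow> 'a :: field_char_0 \<Rightarrow> 'a" where
  "bell_harm r n c = complete_bell r (\<lambda>s. fact (s - 1) * shifted_harm s n c)"

end

theory Submission
  imports Defs
begin

text \<open>
  The case \<open>r = 0\<close> is a transformation of a truncated Gauss series. After clearing denominators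
  it becomes an identity between polynomials in \<open>a, b, c\<close> with integer coefficients, so it holds in
  every commutative ring (\<open>truncated_gauss_transformation\<close>). All other \<open>r\<close> come from this one
  identity by deforming \<open>c\<close>. In the ring of formal power series, replace \<open>c\<close> by \<open>c - X\<close>, so that
  \<open>\<delta> = 1 + a + b - c\<close> becomes \<open>\<delta> + X\<close>. Since
  \<open>1 / (1 - z X) = exp (\<Sum>s. z\<^sup>s X\<^sup>s / s)\<close> and \<open>1 + z X = exp (\<Sum>s. (-1)\<^sup>s\<^sup>-\<^sup>1 z\<^sup>s X\<^sup>s / s)\<close>,
  the quotient \<open>(c)\<^sub>n / (c - X)\<^sub>n\<close> is the generating function of the Bell polynomials in the
  harmonic sums of \<open>c\<close>, and \<open>(\<delta> + X)\<^sub>j / (\<delta>)\<^sub>j\<close> is the one for the alternating harmonic sums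
  of \<open>\<delta>\<close> (\<open>pochhammer_minus_X_bell\<close> and \<open>pochhammer_plus_X_bell\<close>). Bell generating functions
  turn sums of arguments into products, and comparing the coefficients of \<open>X\<^sup>r\<close> in the deformed
  identity gives the theorem.
\<close>

section \<open>A transformation of truncated Gauss sums in commutative rings\<close>

lemma pochhammer_shift_Suc_left:
  fixes a :: "'a :: comm_ring_1"
  assumes "j \<le> m"
  shows "pochhammer (a + of_nat j) (Suc m - j) = (a + of_nat j) * pochhammer (a + 1 + of_nat j) (m - j)"
  using assms by (simp add: Suc_diff_le pochhammer_rec add_ac)

lemma pochhammer_shift_Suc_right:
  fixes a :: "'a :: comm_ring_1"
  assumes "j \<le> m"
  shows "pochhammer (a + of_nat j) (Suc m - j) = pochhammer (a + of_nat j) (m - j) * (a + of_nat m)"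
  using assms by (simp add: Suc_diff_le pochhammer_Suc)

text \<open>
  Both sides satisfy \<open>S (m + 1) = (m + 1) (c + m) S m + (a)\<^sub>m\<^sub>+\<^sub>1 (b)\<^sub>m\<^sub>+\<^sub>1\<close>. On the left this only
  isolates the last summand. On the right it is a telescoping sum with the certificate \<open>G\<close> below;
  the summand-wise relation is a multiple of
  \<open>(a + m + 1) (b + m + 1) - (a + j) (b + j) = (m + 1 - j) (a + b + m + 1 + j)\<close>, whose second
  factor is \<open>(c + m) + (\<delta> + j)\<close>.
\<close>

lemma truncated_gauss_transformation:
  fixes a b c d :: "'a :: comm_ring_1"
  assumes d: "d = 1 + a + b - c"
  shows "(\<Sum>n\<le>m. pochhammer a n * pochhammer b n * pochhammer (c + of_nat n) (m - n)
             * pochhammer (1 + of_nat n) (m - n)) =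
    (\<Sum>j\<le>m. (-1) ^ j * of_nat ((m choose j) * fact j) * pochhammer d j
             * pochhammer (a + 1 + of_nat j) (m - j) * pochhammer (b + 1 + of_nat j) (m - j))"
proof (induction m)
  case 0
  show ?case by simp
next
  case (Suc m)
  define L where "L m = (\<Sum>n\<le>m. pochhammer a n * pochhammer b n * pochhammer (c + of_nat n) (m - n)
             * pochhammer (1 + of_nat n) (m - n))" for m
  \<comment> \<open>The falling factorial \<open>m! / (m - j)!\<close>, with no division in the ring.\<close>
  define p :: "nat \<Rightarrow> nat \<Rightarrow> 'a" where "p m j = of_nat ((m choose j) * fact j)" for m j
  define F where "F m j = (-1) ^ j * p m j * pochhammer d j
             * pochhammer (a + 1 + of_nat j) (m - j) * pochhammer (b + 1 + of_nat j) (m - j)" for m j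
  define G where "G j = - ((-1) ^ j * p (Suc m) j * pochhammer d j
             * pochhammer (a + of_nat j) (Suc m - j) * pochhammer (b + of_nat j) (Suc m - j))" for j
  have L: "L (Suc m) = of_nat (Suc m) * (c + of_nat m) * L m + pochhammer a (Suc m) * pochhammer b (Suc m)"
  proof -
    have "(\<Sum>n\<le>m. pochhammer a n * pochhammer b n * pochhammer (c + of_nat n) (Suc m - n)
             * pochhammer (1 + of_nat n) (Suc m - n)) = of_nat (Suc m) * (c + of_nat m) * L m"
      unfolding L_def sum_distrib_left
      by (intro sum.cong refl) (simp add: pochhammer_shift_Suc_right mult_ac)
    then show ?thesis by (simp add: L_def)
  qed
  have p1: "p (Suc m) j * (of_nat (Suc m) - of_nat j) = of_nat (Suc m) * p m j" if "j \<le> m" for j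
  proof -
    have "(Suc m choose j) * (Suc m - j) = Suc m * (m choose j)"
      using binomial_absorb_comp[of "Suc m" j] by (simp add: mult.commute)
    then have "((Suc m choose j) * fact j) * (Suc m - j) = Suc m * ((m choose j) * fact j)"
      by (metis mult.commute mult.left_commute)
    from arg_cong[OF this, of "of_nat :: nat \<Rightarrow> 'a"] show ?thesis
      using that by (simp only: p_def of_nat_mult of_nat_diff le_SucI)
  qed
  have p2: "p (Suc m) (Suc j) = of_nat (Suc m) * p m j" for j
  proof -
    have "(Suc m choose Suc j) * fact (Suc j) = (Suc j * (Suc m choose Suc j)) * fact j"
      by (simp only: fact_Suc of_nat_id mult_ac)
    also have "\<dots> = Suc m * ((m choose j) * fact j)"
      by (simp only: Suc_times_binomial mult.assoc)
    finally have "(Suc m choose Suc j) * fact (Suc j) = Suc m * ((m choose j) * fact j)" .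
    then show ?thesis by (simp only: p_def of_nat_mult[symmetric])
  qed
  have step: "F (Suc m) j - of_nat (Suc m) * (c + of_nat m) * F m j = G (Suc j) - G j" if j: "j \<le> m" for j
  proof -
    define A where "A = pochhammer (a + 1 + of_nat j) (m - j)"
    define B where "B = pochhammer (b + 1 + of_nat j) (m - j)"
    define D where "D = pochhammer d j"
    have 1: "F (Suc m) j = (-1) ^ j * p (Suc m) j * D * (A * (a + 1 + of_nat m)) * (B * (b + 1 + of_nat m))"
      unfolding F_def A_def B_def D_def using pochhammer_shift_Suc_right[OF j, of "a + 1"]
        pochhammer_shift_Suc_right[OF j, of "b + 1"] by simp
    have 2: "F m j = (-1) ^ j * p m j * D * A * B"
      by (simp add: F_def A_def B_def D_def)
    have 3: "G j = - ((-1) ^ j * p (Suc m) j * D * ((a + of_nat j) * A) * ((b + of_nat j) * B))"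
      unfolding G_def A_def B_def D_def
      by (simp only: pochhammer_shift_Suc_left[OF j])
    have 4: "G (Suc j) = (-1) ^ j * (of_nat (Suc m) * p m j) * (D * (d + of_nat j)) * A * B"
      unfolding G_def A_def B_def D_def p2 by (simp add: pochhammer_Suc add_ac)
    have "F (Suc m) j + G j = (-1) ^ j * D * A * B
        * (p (Suc m) j * (of_nat (Suc m) - of_nat j)) * (c + of_nat m + d + of_nat j)"
      unfolding 1 3 d by (simp add: algebra_simps)
    also have "\<dots> = of_nat (Suc m) * (c + of_nat m) * F m j + G (Suc j)"
      unfolding p1[OF j] 2 4 by (simp only: algebra_simps)
    finally show ?thesis by (simp add: algebra_simps)
  qed
  have last: "F (Suc m) (Suc m) = - G (Suc m)"
    by (simp add: F_def G_def)
  have first: "G 0 = - (pochhammer a (Suc m) * pochhammer b (Suc m))"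
    by (simp add: G_def p_def)
  have "(\<Sum>j\<le>m. F (Suc m) j) - of_nat (Suc m) * (c + of_nat m) * (\<Sum>j\<le>m. F m j) = (\<Sum>j\<le>m. G (Suc j) - G j)"
    unfolding sum_distrib_left sum_subtractf[symmetric] by (intro sum.cong refl step) simp
  also have "\<dots> = G (Suc m) - G 0"
    using sum_lessThan_telescope[of G "Suc m"] by (simp only: lessThan_Suc_atMost)
  finally have "(\<Sum>j\<le>Suc m. F (Suc m) j) =
      of_nat (Suc m) * (c + of_nat m) * (\<Sum>j\<le>m. F m j) + pochhammer a (Suc m) * pochhammer b (Suc m)"
    by (simp add: last first algebra_simps)
  moreover have "L m = (\<Sum>j\<le>m. F m j)"
    unfolding L_def F_def p_def by (rule Suc.IH)
  ultimately have "L (Suc m) = (\<Sum>j\<le>Suc m. F (Suc m) j)"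
    using L by simp
  then show ?case
    unfolding L_def F_def p_def .
qed

section \<open>Generating functions of complete Bell polynomials\<close>

definition bell_gf :: "(nat \<Rightarrow> 'a :: field_char_0) \<Rightarrow> 'a fps" where
  "bell_gf x = fps_exp 1 oo bell_exponent x"

lemma bell_gf_nth: "fps_nth (bell_gf x) r = complete_bell r x / fact r"
  unfolding bell_gf_def complete_bell_gf by simp

lemma bell_gf_cong: "(\<And>s. 1 \<le> s \<Longrightarrow> x s = y s) \<Longrightarrow> bell_gf x = bell_gf y"
  by (auto simp: fps_eq_iff bell_gf_nth intro!: complete_bell_cong)

lemma fps_exp_compose_nth_0: "fps_nth (fps_exp (1 :: 'a :: field_char_0) oo f) 0 = 1"
  by (simp add: fps_compose_nth)

lemma fps_deriv_exp_compose:
  fixes f :: "'a :: field_char_0 fps"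
  assumes "fps_nth f 0 = 0"
  shows "fps_deriv (fps_exp 1 oo f) = fps_deriv f * (fps_exp 1 oo f)"
  using fps_compose_deriv[OF assms, of "fps_exp 1"] by (simp add: mult.commute)

text \<open>
  The exponential of \<open>f\<close> is determined by its linear differential equation: any solution \<open>F\<close>,
  multiplied by \<open>exp (- f)\<close>, has derivative zero, so all solutions with constant term one are
  inverses of the same series.
\<close>

lemma fps_exp_compose_eqI:
  fixes f F :: "'a :: field_char_0 fps"
  assumes f0: "fps_nth f 0 = 0" and F0: "fps_nth F 0 = 1" and F: "fps_deriv F = fps_deriv f * F"
  shows "F = fps_exp 1 oo f"
proof -
  define E where "E = fps_exp 1 oo (- f)"
  have E0: "fps_nth E 0 = 1" unfolding E_def by (rule fps_exp_compose_nth_0)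
  have E: "fps_deriv E = - fps_deriv f * E"
    unfolding E_def using fps_deriv_exp_compose[of "- f"] f0 by simp
  have inv: "H * E = 1" if "fps_nth H 0 = 1" and "fps_deriv H = fps_deriv f * H" for H
  proof -
    have "fps_deriv (H * E) = 0"
      by (simp add: E that(2))
    then have "H * E = fps_const (fps_nth (H * E) 0)"
      by (simp only: fps_deriv_eq_0_iff)
    then show ?thesis by (simp add: that(1) E0)
  qed
  have "F * E = 1" by (rule inv) fact+
  moreover have "(fps_exp 1 oo f) * E = 1"
    by (rule inv) (simp_all only: fps_exp_compose_nth_0 fps_deriv_exp_compose[OF f0])
  ultimately show ?thesis
    by (metis mult.assoc mult.commute mult_1)
qed

lemma bell_exponent_nth_0 [simp]: "fps_nth (bell_exponent x) 0 = 0"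
  by (simp add: bell_exponent_def)

lemma bell_gf_add: "bell_gf (\<lambda>s. x s + y s) = bell_gf x * bell_gf y"
proof -
  have add: "bell_exponent (\<lambda>s. x s + y s) = bell_exponent x + bell_exponent y"
    by (simp add: fps_eq_iff bell_exponent_def add_divide_distrib)
  show ?thesis
    unfolding bell_gf_def
    by (rule fps_exp_compose_eqI[symmetric])
      (simp_all add: fps_exp_compose_nth_0 fps_deriv_exp_compose add algebra_simps)
qed

lemma bell_gf_zero: "bell_gf (\<lambda>s. 0) = 1"
proof -
  have "bell_exponent (\<lambda>s. 0 :: 'a) = 0"
    by (simp add: fps_eq_iff bell_exponent_def)
  then show ?thesis
    unfolding bell_gf_def
    by (intro fps_exp_compose_eqI[symmetric]) simp_all
qed

text \<open>The exponent is the Mercator series of \<open>ln (1 + z X)\<close>.\<close>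

lemma bell_gf_alternating_powers:
  "bell_gf (\<lambda>s. fact (s - 1) * ((-1) ^ (s - 1) * z ^ s)) = 1 + fps_const z * fps_X"
proof -
  let ?e = "bell_exponent (\<lambda>s. fact (s - 1) * ((-1) ^ (s - 1) * z ^ s))"
  have e: "fps_deriv ?e = Abs_fps (\<lambda>n. (-1) ^ n * z ^ Suc n)"
    by (simp add: fps_eq_iff bell_exponent_def field_simps fact_Suc del: of_nat_Suc)
  have "fps_deriv ?e * (1 + fps_const z * fps_X) = fps_const z"
    unfolding fps_eq_iff
  proof
    fix n
    show "fps_nth (fps_deriv ?e * (1 + fps_const z * fps_X)) n = fps_nth (fps_const z) n"
      unfolding e by (cases n) (simp_all add: algebra_simps)
  qed
  then show ?thesis
    unfolding bell_gf_def
    by (intro fps_exp_compose_eqI[symmetric]) simp_all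
qed

text \<open>
  Here \<open>1 / (1 - z X)\<close> is obtained from the preceding series at \<open>- z\<close>: the two arguments are
  negatives of each other in every index that matters, so their generating functions are inverse.
\<close>

lemma bell_gf_powers:
  "bell_gf (\<lambda>s. fact (s - 1) * z ^ s) * (1 - fps_const z * fps_X) = 1"
proof -
  let ?x = "\<lambda>s. fact (s - 1) * z ^ s" and ?y = "\<lambda>s. fact (s - 1) * ((-1) ^ (s - 1) * (- z) ^ s)"
  have "?x s + ?y s = 0" if "1 \<le> s" for s
  proof -
    have "(-1) ^ (s - 1) * (- z) ^ s = - (z ^ s)"
      using that by (cases s) (simp_all add: power_minus[of z])
    then show ?thesis by simp
  qed
  then have "bell_gf (\<lambda>s. ?x s + ?y s) = bell_gf (\<lambda>s. 0)"
    by (rule bell_gf_cong)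
  then show ?thesis
    unfolding bell_gf_add bell_gf_zero bell_gf_alternating_powers
    by (simp add: fps_const_neg[symmetric] del: fps_const_neg)
qed

section \<open>Deformed Pochhammer symbols\<close>

lemma pochhammer_fps_const: "pochhammer (fps_const a) n = fps_const (pochhammer a n)"
  by (induction n) (simp_all add: pochhammer_Suc fps_of_nat[symmetric])

lemma pochhammer_minus_X_bell:
  fixes c :: "'a :: field_char_0"
  assumes "\<And>k. k < n \<Longrightarrow> c + of_nat k \<noteq> 0"
  shows "pochhammer (fps_const c - fps_X) n * bell_gf (\<lambda>s. fact (s - 1) * shifted_harm s n c)
    = fps_const (pochhammer c n)"
  using assms
proof (induction n)
  case 0
  show ?case by (simp add: shifted_harm_def bell_gf_zero)
next
  case (Suc n)
  define w where "w = c + of_nat n"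
  have w: "w \<noteq> 0" using Suc.prems[of n] by (simp add: w_def)
  have "(\<lambda>s. fact (s - 1) * shifted_harm s (Suc n) c) =
      (\<lambda>s. fact (s - 1) * shifted_harm s n c + fact (s - 1) * (1 / w) ^ s)"
    by (simp add: shifted_harm_def w_def fun_eq_iff power_divide algebra_simps)
  then have split: "bell_gf (\<lambda>s. fact (s - 1) * shifted_harm s (Suc n) c) =
      bell_gf (\<lambda>s. fact (s - 1) * shifted_harm s n c) * bell_gf (\<lambda>s. fact (s - 1) * (1 / w) ^ s)"
    by (simp only: bell_gf_add)
  have "fps_const c - fps_X + of_nat n = fps_const w * (1 - fps_const (1 / w) * fps_X)"
    using w by (simp add: w_def fps_of_nat[symmetric] right_diff_distrib mult.assoc[symmetric])
  then have "(fps_const c - fps_X + of_nat n) * bell_gf (\<lambda>s. fact (s - 1) * (1 / w) ^ s) = fps_const w"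
    using bell_gf_powers[of "1 / w"] by (simp add: mult.assoc mult.commute[of "bell_gf _"])
  then show ?case
    using Suc unfolding split by (simp add: pochhammer_Suc w_def fps_const_mult[symmetric] mult_ac del: fps_const_mult)
qed

lemma pochhammer_plus_X_bell:
  fixes d :: "'a :: field_char_0"
  assumes "\<And>k. k < n \<Longrightarrow> d + of_nat k \<noteq> 0"
  shows "pochhammer (fps_const d + fps_X) n =
    fps_const (pochhammer d n) * bell_gf (\<lambda>s. fact (s - 1) * ((-1) ^ (s - 1) * shifted_harm s n d))"
  using assms
proof (induction n)
  case 0
  show ?case by (simp add: shifted_harm_def bell_gf_zero)
next
  case (Suc n)
  define w where "w = d + of_nat n"
  have w: "w \<noteq> 0" using Suc.prems[of n] by (simp add: w_def)
  have "(\<lambda>s. fact (s - 1) * ((-1) ^ (s - 1) * shifted_harm s (Suc n) d)) =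
      (\<lambda>s. fact (s - 1) * ((-1) ^ (s - 1) * shifted_harm s n d)
         + fact (s - 1) * ((-1) ^ (s - 1) * (1 / w) ^ s))"
    by (simp add: shifted_harm_def w_def fun_eq_iff power_divide algebra_simps)
  then have split: "bell_gf (\<lambda>s. fact (s - 1) * ((-1) ^ (s - 1) * shifted_harm s (Suc n) d)) =
      bell_gf (\<lambda>s. fact (s - 1) * ((-1) ^ (s - 1) * shifted_harm s n d)) * (1 + fps_const (1 / w) * fps_X)"
    by (simp only: bell_gf_add bell_gf_alternating_powers)
  have "fps_const d + fps_X + of_nat n = fps_const w * (1 + fps_const (1 / w) * fps_X)"
    using w by (simp add: w_def fps_of_nat[symmetric] distrib_left mult.assoc[symmetric])
  then show ?case
    using Suc unfolding split
    by (simp add: pochhammer_Suc w_def fps_const_mult[symmetric] mult_ac del: fps_const_mult)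
qed

text \<open>
  The summand on the left of the deformed identity: since \<open>(c - X + n)\<^sub>m\<^sub>-\<^sub>n\<close> is the quotient of
  \<open>(c - X)\<^sub>m\<close> by \<open>(c - X)\<^sub>n\<close>, it exchanges the Bell series of index \<open>m\<close> for that of index \<open>n\<close>.
\<close>

lemma pochhammer_minus_X_bell_shift:
  fixes c :: "'a :: field_char_0"
  assumes c: "\<And>k. k < m \<Longrightarrow> c + of_nat k \<noteq> 0" and n: "n \<le> m"
  shows "fps_const (pochhammer c n) * (pochhammer (fps_const c - fps_X + of_nat n) (m - n)
      * bell_gf (\<lambda>s. fact (s - 1) * shifted_harm s m c))
    = fps_const (pochhammer c m) * bell_gf (\<lambda>s. fact (s - 1) * shifted_harm s n c)"
proof -
  have m: "pochhammer (fps_const c - fps_X) n * pochhammer (fps_const c - fps_X + of_nat n) (m - n)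
      * bell_gf (\<lambda>s. fact (s - 1) * shifted_harm s m c) = fps_const (pochhammer c m)"
    unfolding pochhammer_product[OF n, of "fps_const c - fps_X", symmetric]
    by (rule pochhammer_minus_X_bell) (rule c)
  have n: "fps_const (pochhammer c n) = pochhammer (fps_const c - fps_X) n
      * bell_gf (\<lambda>s. fact (s - 1) * shifted_harm s n c)"
    using pochhammer_minus_X_bell[of n c] c n by simp
  show ?thesis unfolding n m[symmetric] by (simp only: mult_ac)
qed

text \<open>
  The summand on the right. For \<open>r = 0\<close> only constant terms matter, and these agree even when
  \<open>(d)\<^sub>j = 0\<close>, where the alternating harmonic sums of \<open>d\<close> involve a division by zero.
\<close>

lemma pochhammer_plus_X_bell_nth:
  fixes c d :: "'a :: field_char_0"
  assumes d: "\<And>k. 1 \<le> r \<Longrightarrow> k < j \<Longrightarrow> d + of_nat k \<noteq> 0"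
  shows "fps_nth (pochhammer (fps_const d + fps_X) j * bell_gf (\<lambda>s. fact (s - 1) * shifted_harm s m c)) r
    = pochhammer d j * complete_bell r (\<lambda>s. fact (s - 1) *
        (shifted_harm s m c + (-1) ^ (s - 1) * shifted_harm s j d)) / fact r"
proof (cases "r = 0")
  case True
  have "fps_nth (pochhammer (fps_const d + fps_X) j) 0 = pochhammer d j"
    by (induction j) (simp_all add: pochhammer_Suc fps_of_nat[symmetric])
  then show ?thesis by (simp add: True bell_gf_nth)
next
  case False
  have "pochhammer (fps_const d + fps_X) j * bell_gf (\<lambda>s. fact (s - 1) * shifted_harm s m c) =
      fps_const (pochhammer d j) * bell_gf (\<lambda>s. fact (s - 1) * shifted_harm s m c
        + fact (s - 1) * ((-1) ^ (s - 1) * shifted_harm s j d))"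
    using d False by (subst pochhammer_plus_X_bell) (simp_all add: bell_gf_add mult_ac)
  then show ?thesis by (simp add: bell_gf_nth distrib_left)
qed

section \<open>Comparison of coefficients\<close>

lemma pochhammer_shift_quotient:
  fixes z :: "'a :: field_char_0"
  assumes "n \<le> m" and "pochhammer z n \<noteq> 0"
  shows "pochhammer (z + of_nat n) (m - n) = pochhammer z m / pochhammer z n"
  using assms pochhammer_product[OF assms(1), of z] by simp

theorem theorem6p2:
  fixes m r :: nat and a b c \<delta> :: complex
  assumes c: "c \<notin> \<int>\<^sub>\<le>\<^sub>0"
    and a: "\<And>k. 1 \<le> k \<Longrightarrow> k \<le> m \<Longrightarrow> a \<noteq> - of_nat k"
    and b: "\<And>k. 1 \<le> k \<Longrightarrow> k \<le> m \<Longrightarrow> b \<noteq> - of_nat k"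
    and \<delta>_def: "\<delta> = 1 + a + b - c"
    and \<delta>: "\<And>k. 1 \<le> r \<Longrightarrow> k < m \<Longrightarrow> \<delta> + of_nat k \<noteq> 0"
  shows "(\<Sum>n = 0..m. pochhammer a n * pochhammer b n / (pochhammer c n * fact n) * bell_harm r n c) =
    pochhammer (a + 1) m * pochhammer (b + 1) m / (pochhammer c m * fact m) *
    (\<Sum>j = 0..m. (- 1) ^ j * of_nat (m choose j) *
        (pochhammer \<delta> j * fact j / (pochhammer (a + 1) j * pochhammer (b + 1) j)) *
        complete_bell r (\<lambda>s. fact (s - 1) *
          (shifted_harm s m c + (- 1) ^ (s - 1) * shifted_harm s j \<delta>)))"
proof -
  define H where "H n = bell_gf (\<lambda>s. fact (s - 1) * shifted_harm s n c)" for n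
  define C where "C j = complete_bell r (\<lambda>s. fact (s - 1) *
          (shifted_harm s m c + (- 1) ^ (s - 1) * shifted_harm s j \<delta>))" for j
  have c_ne: "c + of_nat k \<noteq> 0" for k
    using c plus_of_nat_eq_0_imp by blast
  have cn: "pochhammer c n \<noteq> 0" for n
    using c pochhammer_eq_0_imp_nonpos_Int by blast
  have shift_ne: "pochhammer (z + 1) j \<noteq> 0"
    if "\<And>k. 1 \<le> k \<Longrightarrow> k \<le> m \<Longrightarrow> z \<noteq> - of_nat k" "j \<le> m" for z :: complex and j
  proof
    assume "pochhammer (z + 1) j = 0"
    then obtain k where "k < j" "z + 1 = - of_nat k"
      by (auto simp: pochhammer_eq_0_iff)
    then show False
      using that(1)[of "Suc k"] that(2) by (auto simp: algebra_simps eq_neg_iff_add_eq_0)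
  qed
  note an = shift_ne[OF a] and bn = shift_ne[OF b]
  have const: "fps_const z + 1 + of_nat j = fps_const (z + 1 + of_nat j)"
    "(1 :: complex fps) + of_nat j = fps_const (1 + of_nat j)" for z :: complex and j
    by (simp_all add: fps_of_nat[symmetric] fps_const_add[symmetric] del: fps_const_add)
  have "fps_const \<delta> + fps_X = 1 + fps_const a + fps_const b - (fps_const c - fps_X)"
    by (simp add: \<delta>_def fps_eq_iff)
  note truncated_gauss_transformation[OF this, of m]
  \<comment> \<open>The factor \<open>H m\<close> restores, up to \<open>(c)\<^sub>m\<close>, the division by \<open>(c - X)\<^sub>m\<close> on both sides.\<close>
  note deformed = arg_cong[OF this, of "\<lambda>f. fps_nth (f * H m) r"]
  have scale: "fps_nth (fps_const z * f) r = z * fps_nth f r" for z :: complex and f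
    by simp
  have eq: "(\<Sum>n\<le>m. pochhammer a n * pochhammer b n * pochhammer (1 + of_nat n) (m - n)
        * fps_nth (pochhammer (fps_const c - fps_X + of_nat n) (m - n) * H m) r) =
      (\<Sum>j\<le>m. (-1) ^ j * of_nat (m choose j) * fact j * pochhammer (a + 1 + of_nat j) (m - j)
        * pochhammer (b + 1 + of_nat j) (m - j) * fps_nth (pochhammer (fps_const \<delta> + fps_X) j * H m) r)"
  proof -
    have "fps_nth (pochhammer (fps_const a) n * pochhammer (fps_const b) n
        * pochhammer (fps_const c - fps_X + of_nat n) (m - n) * pochhammer (1 + of_nat n) (m - n) * H m) r =
      pochhammer a n * pochhammer b n * pochhammer (1 + of_nat n) (m - n)
        * fps_nth (pochhammer (fps_const c - fps_X + of_nat n) (m - n) * H m) r" for n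
      unfolding scale[symmetric] const pochhammer_fps_const fps_const_mult[symmetric] by (simp only: mult_ac)
    moreover have "fps_nth ((-1) ^ j * of_nat ((m choose j) * fact j) * pochhammer (fps_const \<delta> + fps_X) j
        * pochhammer (fps_const a + 1 + of_nat j) (m - j) * pochhammer (fps_const b + 1 + of_nat j) (m - j)
        * H m) r =
      (-1) ^ j * of_nat (m choose j) * fact j * pochhammer (a + 1 + of_nat j) (m - j)
        * pochhammer (b + 1 + of_nat j) (m - j) * fps_nth (pochhammer (fps_const \<delta> + fps_X) j * H m) r" for j
    proof -
      have "(-1) ^ j * of_nat ((m choose j) * fact j) =
          fps_const ((-1) ^ j * of_nat (m choose j) * fact j :: complex)"
        by (cases "even j") (simp_all add: fps_of_nat[symmetric])
      then show ?thesis
        unfolding scale[symmetric] const pochhammer_fps_const fps_const_mult[symmetric] by (simp only: mult_ac)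
    qed
    ultimately show ?thesis
      using deformed unfolding sum_distrib_right fps_sum_nth by simp
  qed
  have left: "fps_nth (pochhammer (fps_const c - fps_X + of_nat n) (m - n) * H m) r =
      pochhammer c m / pochhammer c n * bell_harm r n c / fact r" if "n \<le> m" for n
    using arg_cong[OF pochhammer_minus_X_bell_shift[OF c_ne that], of "\<lambda>f. fps_nth f r"] cn[of n]
    by (simp add: H_def bell_gf_nth bell_harm_def field_simps)
  have right: "fps_nth (pochhammer (fps_const \<delta> + fps_X) j * H m) r = pochhammer \<delta> j * C j / fact r"
    if "j \<le> m" for j
    unfolding H_def C_def using \<delta> that by (intro pochhammer_plus_X_bell_nth) auto
  have fct: "pochhammer (1 + of_nat n :: complex) (m - n) = fact m / fact n" if "n \<le> m" for n
    using pochhammer_shift_quotient[OF that, of "1 :: complex"] by (simp add: pochhammer_fact[symmetric])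
  have "pochhammer c m * fact m / fact r *
      (\<Sum>n\<le>m. pochhammer a n * pochhammer b n / (pochhammer c n * fact n) * bell_harm r n c) =
    (\<Sum>n\<le>m. pochhammer a n * pochhammer b n * pochhammer (1 + of_nat n) (m - n)
        * fps_nth (pochhammer (fps_const c - fps_X + of_nat n) (m - n) * H m) r)"
    unfolding sum_distrib_left by (intro sum.cong refl) (simp add: left fct, simp only: mult_ac)
  also note eq
  also have "(\<Sum>j\<le>m. (-1) ^ j * of_nat (m choose j) * fact j * pochhammer (a + 1 + of_nat j) (m - j)
        * pochhammer (b + 1 + of_nat j) (m - j) * fps_nth (pochhammer (fps_const \<delta> + fps_X) j * H m) r) =
    pochhammer (a + 1) m * pochhammer (b + 1) m / fact r *
      (\<Sum>j\<le>m. (- 1) ^ j * of_nat (m choose j) *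
        (pochhammer \<delta> j * fact j / (pochhammer (a + 1) j * pochhammer (b + 1) j)) * C j)"
    unfolding sum_distrib_left
    by (intro sum.cong refl) (simp add: right pochhammer_shift_quotient an bn, simp only: mult_ac)
  finally show ?thesis
    unfolding C_def[symmetric] atLeast0AtMost using cn[of m] by (simp add: field_simps)
qed

end
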